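(* Let $k\ge 1$ and let $i=(i_1,\dots,i_k)$ be a $k$-tuple of integers with $i_p\ge 2$ for $p=1,\dots,k$. Then $$\mathrm{I}(A_2,i)=i_1+\cdots+i_k-k+1,$$ where $A_2$ is the free associative unitary algebra on two generators over a field of characteristic zero. That is, $M_{i_1}(A_2)\cdots M_{i_k}(A_2)\subset M_{i_1+\cdots+i_k-k+1}(A_2)$, while $M_{i_1}(A_2)\cdots M_{i_k}(A_2)\not\subset M_{i_1+\cdots+i_k-k+2}(A_2)$.
   Context: $\mathcal{K}$ is a field of characteristic zero, and $A_n$ is the free associative unitary $\mathcal{K}$-algebra on generators $x_1,\dots,x_n$. For an associative unitary $\mathcal{K}$-algebra $R$ put $[a,b]=ab-ba$. Define $L_1(R)=R$ and, for $i\ge 2$, $L_i(R)=[R,L_{i-1}(R)]$ (the linear span of all $[a,l]$ with $a\in R$, $l\in L_{i-1}(R)$). Let $M_i(R)=R\cdot L_i(R)\cdot R$ be the two-sided ideal of $R$ generated by $L_i(R)$; then $M_1(R)\supset M_2(R)\supset\cdots$. Products of ideals are the usual ones (linear spans of products of elements). For a $k$-tuple $i=(i_1,\dots,i_k)$ with all $i_p\ge 2$, $\mathrm{I}(R,i)$ denotes the maximal index $m\in\mathbb{N}$ such that $M_{i_1}(R)\cdots M_{i_k}(R)\subset M_m(R)$, i.e. the product is contained in $M_{m}(R)$ but not in $M_{m+1}(R)$. *)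

theory Defs
  imports Complex_Main "HOL-Library.Poly_Mapping" "HOL-Library.Numeral_Type"
begin

definition commutator :: "'a::ring_1 \<Rightarrow> 'a \<Rightarrow> 'a"
  where "commutator a b = a * b - b * a"

locale assoc_unital_algebra = vector_space scale
  for scale :: "'k::field \<Rightarrow> 'r::ring_1 \<Rightarrow> 'r" (infixr \<open>*s\<close> 75) +
  assumes scale_mult_left: "(c *s a) * b = c *s (a * b)"
    and scale_mult_right: "a * (c *s b) = c *s (a * b)"
begin

text \<open>The series starts at index \<open>1\<close>; the value at index \<open>0\<close> is a dummy.\<close>

fun lower_central :: "nat \<Rightarrow> 'r set" where
  "lower_central 0 = UNIV"
| "lower_central (Suc 0) = UNIV"
| "lower_central (Suc (Suc n)) =
     span {commutator a l | a l. l \<in> lower_central (Suc n)}"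

definition lower_ideal :: "nat \<Rightarrow> 'r set"
  where "lower_ideal n = span {a * l * b | a l b. l \<in> lower_central n}"

text \<open>For a tuple \<open>[i\<^sub>1, \<dots>, i\<^sub>k]\<close> with \<open>k \<ge> 1\<close> this is the product of ideals
  \<open>M\<^sub>i\<^sub>1 \<cdots> M\<^sub>i\<^sub>k\<close>: the span of all \<open>x\<^sub>1 \<cdots> x\<^sub>k\<close> with \<open>x\<^sub>p\<close> in the ideal
  with index \<open>i\<^sub>p\<close>.\<close>

definition lower_ideal_product :: "nat list \<Rightarrow> 'r set"
  where "lower_ideal_product ps =
    span {prod_list xs | xs. list_all2 (\<lambda>x p. x \<in> lower_ideal p) xs ps}"

definition max_index :: "nat list \<Rightarrow> nat"
  where "max_index ps = (GREATEST m. 1 \<le> m \<and> lower_ideal_product ps \<subseteq> lower_ideal m)"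

end

text \<open>The free algebra is the monoid algebra of the free monoid on the generators.
  Words are wrapped in a type of their own so that they can be made an additively written
  (noncommutative) monoid, on which \<^typ>\<open>'a \<Rightarrow>\<^sub>0 'b\<close> carries the convolution product.\<close>

datatype 'x free_monoid = Word (letters: "'x list")

instantiation free_monoid :: (type) monoid_add
begin

definition zero_free_monoid :: "'a free_monoid"
  where "0 = Word []"

definition plus_free_monoid :: "'a free_monoid \<Rightarrow> 'a free_monoid \<Rightarrow> 'a free_monoid"
  where "u + v = Word (letters u @ letters v)"

instance
  by standard (simp_all add: zero_free_monoid_def plus_free_monoid_def)

end

type_synonym ('k, 'x) free_algebra = "'x free_monoid \<Rightarrow>\<^sub>0 'k"

lift_definition free_algebra_scale ::
  "'k::field \<Rightarrow> ('k, 'x) free_algebra \<Rightarrow> ('k, 'x) free_algebra"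
  is "\<lambda>c f w. c * f w"
  by (erule rev_finite_subset) auto

lemma free_algebra_scale_eq_mult:
  fixes c :: "'a::field" and f :: "('a, 'b) free_algebra"
  shows "free_algebra_scale c f = Poly_Mapping.single 0 c * f"
proof (rule poly_mapping_eqI)
  fix w :: "'b free_monoid"
  have "Poly_Mapping.lookup (Poly_Mapping.single 0 c * f) w =
      (\<Sum>l. (c when 0 = l) * (\<Sum>q. (Poly_Mapping.lookup f q when w = l + q)))"
    by (simp only: times_poly_mapping.rep_eq prod_fun_def lookup_single)
  also have "\<dots> = (\<Sum>l::'b free_monoid. (c * Poly_Mapping.lookup f w when l = 0))"
    by (rule Sum_any.cong) (simp add: when_def)
  finally show "Poly_Mapping.lookup (free_algebra_scale c f) w =
      Poly_Mapping.lookup (Poly_Mapping.single 0 c * f) w"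
    by (simp add: free_algebra_scale.rep_eq)
qed

lemma free_algebra_scale_eq_mult_right:
  fixes c :: "'a::field" and f :: "('a, 'b) free_algebra"
  shows "free_algebra_scale c f = f * Poly_Mapping.single 0 c"
proof (rule poly_mapping_eqI)
  fix w :: "'b free_monoid"
  have right_factor: "(\<Sum>q. ((c when 0 = q) when w = l + q)) = (c when w = l)" for l :: "'b free_monoid"
  proof -
    have "(\<Sum>q. ((c when 0 = q) when w = l + q)) = (\<Sum>q::'b free_monoid. ((c when w = l) when q = 0))"
      by (rule Sum_any.cong) (auto simp: when_def)
    then show ?thesis by simp
  qed
  have "Poly_Mapping.lookup (f * Poly_Mapping.single 0 c) w =
      (\<Sum>l. Poly_Mapping.lookup f l * (c when w = l))"
    by (simp only: times_poly_mapping.rep_eq prod_fun_def lookup_single right_factor)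
  also have "\<dots> = (\<Sum>l. (Poly_Mapping.lookup f w * c when l = w))"
    by (rule Sum_any.cong) (auto simp: when_def)
  finally show "Poly_Mapping.lookup (free_algebra_scale c f) w =
      Poly_Mapping.lookup (f * Poly_Mapping.single 0 c) w"
    by (simp add: free_algebra_scale.rep_eq mult.commute)
qed

interpretation free_algebra: assoc_unital_algebra
  "free_algebra_scale :: 'k::field \<Rightarrow> ('k, 'x) free_algebra \<Rightarrow> _"
proof
  fix a b :: 'k and f g :: "('k, 'x) free_algebra"
  show "free_algebra_scale a (f + g) = free_algebra_scale a f + free_algebra_scale a g"
    by (simp add: free_algebra_scale_eq_mult distrib_left)
  show "free_algebra_scale (a + b) f = free_algebra_scale a f + free_algebra_scale b f"
    by (simp add: free_algebra_scale_eq_mult single_add distrib_right)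
  show "free_algebra_scale a (free_algebra_scale b f) = free_algebra_scale (a * b) f"
    by (simp add: free_algebra_scale_eq_mult mult_single flip: mult.assoc)
  show "free_algebra_scale 1 f = f"
    by (simp add: free_algebra_scale_eq_mult)
  show "free_algebra_scale a f * g = free_algebra_scale a (f * g)"
    by (simp add: free_algebra_scale_eq_mult mult.assoc)
  show "f * free_algebra_scale a g = free_algebra_scale a (f * g)"
    by (simp add: free_algebra_scale_eq_mult_right mult.assoc)
qed

text \<open>The two elements of \<^typ>\<open>2\<close> index the two generators.\<close>

type_synonym 'k A2 = "('k, 2) free_algebra"

abbreviation A2_scale :: "'k::field_char_0 \<Rightarrow> 'k A2 \<Rightarrow> 'k A2"
  where "A2_scale \<equiv> free_algebra_scale"

end

(* Lower bound. In every algebra of characteristic 0, [M_j, A] is contained in L_{j+1} for odd j;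
   this gives M_i M_j <= M_{i+j-1} as soon as i or j is odd. For i and j even it suffices to treat
   E(z, u, w) = [z, [u, v]] [w, l] with v in L_{i-2} and l in L_{j-1} (and [z, u] [w, l] if i = 2).
   Modulo M_{i+j-1} this is a derivation in z, since commuting a factor past [z, [u, v]] costs a
   product that involves L_{i+1} with i + 1 odd. Expanding ad_z^2 ([u, v] l) and ad_z^2 (v [w, l])
   with the Leibniz rule, where the products lie in an M_n with n odd (by induction on i for the
   second one), shows that E is alternating
   in (z, w) and in (z, u). So E is an alternating triderivation, which is determined by its
   values on generators, and two generators cannot fill three alternating slots.

   Upper bound. Let x act on K[h][t] as h d/dt and y as multiplication by t. Then [x, y] acts as
   the central element h, so M_m acts by operators divisible by h^{m-1}, whereas
   ad_x^{n}(y^n), which lies in L_{n+1}, sends 1 to n! h^n. *)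

theory Submission
  imports Defs "HOL-Computational_Algebra.Polynomial"
begin

notation commutator (\<open>\<langle>_,/ _\<rangle>\<close>)

lemma commutator_swap: "\<langle>b, a\<rangle> = - \<langle>a, b\<rangle>"
  and commutator_self: "\<langle>a, a\<rangle> = 0"
  and commutator_add_left: "\<langle>a + a', b\<rangle> = \<langle>a, b\<rangle> + \<langle>a', b\<rangle>"
  and commutator_add_right: "\<langle>a, b + b'\<rangle> = \<langle>a, b\<rangle> + \<langle>a, b'\<rangle>"
  and commutator_mult_left: "\<langle>a * a', b\<rangle> = a * \<langle>a', b\<rangle> + \<langle>a, b\<rangle> * a'"
  and commutator_jacobi: "\<langle>a, \<langle>b, c\<rangle>\<rangle> = \<langle>\<langle>a, b\<rangle>, c\<rangle> + \<langle>b, \<langle>a, c\<rangle>\<rangle>"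
  by (simp_all add: commutator_def algebra_simps)

section \<open>Lower central series of associative algebras\<close>

context assoc_unital_algebra
begin

abbreviation (input) "L \<equiv> lower_central"
abbreviation (input) "M \<equiv> lower_ideal"

lemma commutator_scale_left: "\<langle>c *s a, b\<rangle> = c *s \<langle>a, b\<rangle>"
  and commutator_scale_right: "\<langle>a, c *s b\<rangle> = c *s \<langle>a, b\<rangle>"
  by (simp_all add: commutator_def scale_mult_left scale_mult_right scale_right_diff_distrib)

lemmas scale_simps = scale_mult_left scale_mult_right commutator_scale_left commutator_scale_right
  scale_right_distrib
lemmas add_simps = commutator_add_left commutator_add_right distrib_left distrib_right

text \<open>Discharges the \<open>subspace\<close> case of the span inductions below, where a linear
  expression is shown to lie in a subspace.\<close>

lemma subspace_preimage:
  assumes "subspace S" "\<And>x y. f (x + y) = f x + f y" "\<And>c x. f (c *s x) = c *s f x"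
  shows "subspace {x. f x \<in> S}"
proof -
  have "f 0 = 0" using assms(3)[of 0 0] by simp
  with assms show ?thesis by (auto simp: subspace_def)
qed

lemma of_nat_scale: "of_nat n *s v = of_nat n * v"
  by (induction n) (simp_all add: scale_left_distrib distrib_right)

lemma subspace_lower_central: "subspace (L n)"
  by (induction n rule: lower_central.induct) simp_all

lemma lower_central_commutator:
  assumes "l \<in> L n" "1 \<le> n" shows "\<langle>a, l\<rangle> \<in> L (Suc n)"
  using assms by (cases n) (auto intro!: span_base)

lemma lower_central_commutator':
  assumes "l \<in> L n" "1 \<le> n" shows "\<langle>l, a\<rangle> \<in> L (Suc n)"
  using lower_central_commutator[OF assms, of a] subspace_neg[OF subspace_lower_central]
  by (metis commutator_swap)

text \<open>\<open>1 \<le> n\<close> keeps out \<open>L 1\<close>, which is defined as the whole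
  algebra rather than as a span of commutators.\<close>

lemma lower_central_Suc_induct [consumes 2, case_names subspace commutator]:
  assumes "x \<in> L (Suc n)" "1 \<le> n" "subspace {x. P x}" "\<And>a l. l \<in> L n \<Longrightarrow> P \<langle>a, l\<rangle>"
  shows "P x"
proof -
  have "L (Suc n) = span {\<langle>a, l\<rangle> | a l. l \<in> L n}" using assms(2) by (cases n) simp_all
  moreover have "span {\<langle>a, l\<rangle> | a l. l \<in> L n} \<subseteq> {x. P x}"
    using assms(4) by (intro span_minimal assms(3)) blast
  ultimately show ?thesis using assms(1) by blast
qed

declare lower_central.simps(3) [simp del]

lemma lower_central_Suc_subset: "L (Suc n) \<subseteq> L n"
proof (induction n)
  case (Suc n)
  show ?case
  proof (cases n)
    case (Suc k)
    show ?thesis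
    proof
      fix x assume "x \<in> L (Suc (Suc n))"
      moreover have "1 \<le> Suc n" by simp
      ultimately show "x \<in> L (Suc n)"
      proof (induction rule: lower_central_Suc_induct)
        case (commutator a l)
        then show ?case using Suc.IH Suc lower_central_commutator[of l n] by auto
      qed (use subspace_lower_central in simp_all)
    qed
  qed simp
qed simp

lemma lower_central_antimono: "m \<le> n \<Longrightarrow> L n \<subseteq> L m"
  using lift_Suc_antimono_le[of L] lower_central_Suc_subset by blast

text \<open>Jacobi identity and induction on \<open>i\<close>. The term \<open>[l, [u, b]]\<close>
  pairs \<open>L i\<close> with \<open>L (Suc j)\<close>, so \<open>j\<close> stays
  arbitrary.\<close>

lemma lower_central_commutator_lower_central:
  assumes "a \<in> L i" "b \<in> L j" "1 \<le> i" "1 \<le> j"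
  shows "\<langle>a, b\<rangle> \<in> L (i + j)"
  using assms(3,1,2,4)
proof (induction i arbitrary: a b j rule: dec_induct)
  case base
  then show ?case using lower_central_commutator by simp
next
  case (step i)
  from step.prems(1) step.hyps(1) show ?case
  proof (induction rule: lower_central_Suc_induct)
    case subspace
    show ?case
      by (rule subspace_preimage[OF subspace_lower_central]) (simp_all add: add_simps scale_simps)
  next
    case (commutator u l)
    have "\<langle>u, \<langle>l, b\<rangle>\<rangle> \<in> L (Suc (i + j))"
      using step commutator by (intro lower_central_commutator) auto
    moreover have "\<langle>l, \<langle>u, b\<rangle>\<rangle> \<in> L (i + Suc j)"
      using step commutator by (intro step.IH lower_central_commutator) auto
    moreover have "\<langle>\<langle>u, l\<rangle>, b\<rangle> = \<langle>u, \<langle>l, b\<rangle>\<rangle> - \<langle>l, \<langle>u, b\<rangle>\<rangle>"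
      by (simp add: commutator_def algebra_simps)
    ultimately show ?case using subspace_diff[OF subspace_lower_central] by simp
  qed
qed

section \<open>The ideals \<open>M n\<close> and their generators\<close>

lemma subspace_lower_ideal: "subspace (M n)"
  by (simp add: lower_ideal_def)

lemma lower_ideal_sandwich: "l \<in> L n \<Longrightarrow> a * l * b \<in> M n"
  unfolding lower_ideal_def by (rule span_base) blast

lemma lower_central_subset_lower_ideal: "L n \<subseteq> M n"
  using lower_ideal_sandwich[of _ n 1 1] by auto

lemma lower_ideal_induct [consumes 1, case_names subspace mult]:
  assumes "x \<in> M n" "subspace {x. P x}" "\<And>a l b. l \<in> L n \<Longrightarrow> P (a * l * b)"
  shows "P x"
  using span_minimal[of "{a * l * b | a l b. l \<in> L n}" "{x. P x}"] assms
  unfolding lower_ideal_def by blast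

lemma lower_ideal_mult_left: "m \<in> M n \<Longrightarrow> a * m \<in> M n"
proof (induction rule: lower_ideal_induct)
  case (mult u l v)
  then show ?case using lower_ideal_sandwich[of l n "a * u" v] by (simp add: mult.assoc)
qed (rule subspace_preimage[OF subspace_lower_ideal]; simp add: add_simps scale_simps)

lemma lower_ideal_mult_right: "m \<in> M n \<Longrightarrow> m * a \<in> M n"
proof (induction rule: lower_ideal_induct)
  case (mult u l v)
  then show ?case using lower_ideal_sandwich[of l n u "v * a"] by (simp add: mult.assoc)
qed (rule subspace_preimage[OF subspace_lower_ideal]; simp add: add_simps scale_simps)

lemmas lower_ideal_mult = lower_ideal_mult_left lower_ideal_mult_right
lemmas lower_ideal_lin = subspace_add[OF subspace_lower_ideal] subspace_diff[OF subspace_lower_ideal]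
  subspace_neg[OF subspace_lower_ideal] subspace_0[OF subspace_lower_ideal]
lemmas lower_central_lin = subspace_add[OF subspace_lower_central]
  subspace_diff[OF subspace_lower_central] subspace_neg[OF subspace_lower_central]

lemma lower_ideal_antimono: "m \<le> n \<Longrightarrow> M n \<subseteq> M m"
  unfolding lower_ideal_def by (rule span_mono) (use lower_central_antimono in blast)

text \<open>\<open>M n\<close> is already generated as a left ideal:
  \<open>l * b = b * l + [l, b]\<close>, and \<open>[l, b]\<close> lies in \<open>L n\<close>
  again.\<close>

lemma lower_ideal_left_induct [consumes 1, case_names subspace mult]:
  assumes "x \<in> M n" "subspace {x. P x}" "\<And>a l. l \<in> L n \<Longrightarrow> P (a * l)"
  shows "P x"
  using assms(1)
proof (induction rule: lower_ideal_induct)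
  case subspace show ?case by fact
next
  case (mult a l b)
  have "P (a * b * l)" using mult by (rule assms(3))
  moreover have "\<langle>l, b\<rangle> \<in> L n"
    using mult lower_central_commutator'[of l n b] lower_central_Suc_subset[of n]
    by (cases n) auto
  then have "P (a * \<langle>l, b\<rangle>)" by (rule assms(3))
  moreover have "a * l * b = a * b * l + a * \<langle>l, b\<rangle>"
    by (simp add: commutator_def algebra_simps)
  ultimately show ?case using subspace_add[OF assms(2)] by simp
qed

end

section \<open>Products with a factor of odd index\<close>

locale char_0_algebra = assoc_unital_algebra scale
  for scale :: "'k::field_char_0 \<Rightarrow> 'r::ring_1 \<Rightarrow> 'r" (infixr \<open>*s\<close> 75)
begin

text \<open>Characteristic zero enters the lower bound here: identities below carry factors 2 and 3
  that have to be divided out.\<close>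

lemma subspace_of_nat_multD:
  assumes "subspace S" "of_nat n * v \<in> S" "n > 0" shows "v \<in> S"
proof -
  have "inverse (of_nat n) *s (of_nat n * v) \<in> S"
    using assms by (intro subspace_scale)
  then have "inverse (of_nat n) *s (of_nat n *s v) \<in> S"
    by (simp only: of_nat_scale)
  then show ?thesis using assms by simp
qed

text \<open>Found by linear algebra over the rationals in the 120-dimensional space spanned by the words
  that are multilinear in \<open>a, \<dots>, e\<close>. What matters is that every term on the right is a triple
  commutator whose innermost entry contains \<open>d\<close>.\<close>

lemma three_mult_commutator_identity:
  fixes a b c d e :: 'r
  shows "3 * \<langle>a * \<langle>b, \<langle>c, d\<rangle>\<rangle>, e\<rangle> =
    (\<langle>a, \<langle>b, \<langle>c, d * e\<rangle>\<rangle>\<rangle> + \<langle>a, \<langle>c, \<langle>e, d * b\<rangle>\<rangle>\<rangle>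
      + \<langle>a, \<langle>e, \<langle>b, d * c\<rangle>\<rangle>\<rangle> + \<langle>a, \<langle>e * c, \<langle>b, d\<rangle>\<rangle>\<rangle>
      + \<langle>b * e, \<langle>a, \<langle>c, d\<rangle>\<rangle>\<rangle> + \<langle>c * b, \<langle>e, \<langle>a, d\<rangle>\<rangle>\<rangle>
      + \<langle>e, \<langle>a, \<langle>c, d * b\<rangle>\<rangle>\<rangle> + \<langle>e, \<langle>b, \<langle>a, d * c\<rangle>\<rangle>\<rangle>
      + \<langle>e, \<langle>c, \<langle>b, a * d\<rangle>\<rangle>\<rangle> - \<langle>a * e, \<langle>c, \<langle>b, d\<rangle>\<rangle>\<rangle>
      - \<langle>b, \<langle>a, \<langle>c, e * d\<rangle>\<rangle>\<rangle> - \<langle>b, \<langle>c, \<langle>e, d * a\<rangle>\<rangle>\<rangle>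
      - \<langle>b, \<langle>e, \<langle>a, c * d\<rangle>\<rangle>\<rangle> - \<langle>b * a, \<langle>c, \<langle>e, d\<rangle>\<rangle>\<rangle>
      - \<langle>c, \<langle>b * e, \<langle>a, d\<rangle>\<rangle>\<rangle> - \<langle>e * a, \<langle>b, \<langle>c, d\<rangle>\<rangle>\<rangle>
      - \<langle>e * c, \<langle>b, \<langle>a, d\<rangle>\<rangle>\<rangle>)
    + 2 * (\<langle>b, \<langle>a * c, \<langle>e, d\<rangle>\<rangle>\<rangle> + \<langle>c, \<langle>a, \<langle>e, b * d\<rangle>\<rangle>\<rangle>
      + \<langle>c, \<langle>b, \<langle>a, e * d\<rangle>\<rangle>\<rangle> + \<langle>c, \<langle>e, \<langle>b, d * a\<rangle>\<rangle>\<rangle>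
      - \<langle>c * a, \<langle>e, \<langle>b, d\<rangle>\<rangle>\<rangle> - \<langle>c * b, \<langle>a, \<langle>e, d\<rangle>\<rangle>\<rangle>
      - \<langle>e, \<langle>a * b, \<langle>c, d\<rangle>\<rangle>\<rangle>)"
proof -
  have "3 * x = x + (x + x)" for x :: 'r
    using distrib_right[of 1 2 x] by (simp add: mult_2)
  then show ?thesis by (simp only: commutator_def algebra_simps mult_2)
qed


text \<open>Induction in steps of two from \<open>M 1\<close>, the whole algebra, which is why odd
  indices are reached. \<open>M (j + 2)\<close> is spanned by the \<open>a * [b, [c, d]]\<close>
  with \<open>d\<close> in \<open>L j\<close>, and the identity above expresses three times their
  commutators with \<open>e\<close> through triple commutators.\<close>

lemma lower_ideal_odd_commutator:
  assumes "odd j" "m \<in> M j"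
  shows "\<langle>m, e\<rangle> \<in> L (Suc j)"
proof -
  have "\<forall>m \<in> M (2 * k + 1). \<forall>e. \<langle>m, e\<rangle> \<in> L (2 * k + 2)" for k
  proof (induction k)
    case 0
    then show ?case using lower_central_commutator'[of _ 1] by (simp add: numeral_2_eq_2)
  next
    case (Suc k)
    define j where "j = 2 * k + 1"
    \<comment> \<open>The innermost entries of the identity are \<open>d\<close> or \<open>d\<close>
      times one other letter, so \<open>m\<close> ranges over the ideal \<open>M j\<close>. The
      hypothesis places \<open>[r, m]\<close> in \<open>L (Suc j)\<close>; two further commutators
      reach \<open>L (j + 3)\<close>.\<close>
    have triple: "\<langle>p, \<langle>q, \<langle>r, m\<rangle>\<rangle>\<rangle> \<in> L (j + 3)" if "m \<in> M j" for p q r m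
    proof -
      have "\<langle>r, m\<rangle> \<in> L (Suc j)"
        using Suc.IH that lower_central_lin(3) by (simp add: j_def commutator_swap[of r m])
      then show ?thesis
        using lower_central_commutator by (simp add: eval_nat_numeral)
    qed
    have generators: "\<langle>a * \<langle>b, \<langle>c, d\<rangle>\<rangle>, e\<rangle> \<in> L (j + 3)" if "d \<in> L j" for a b c d e
    proof (rule subspace_of_nat_multD[OF subspace_lower_central, of 3])
      have d: "d \<in> M j" using that lower_central_subset_lower_ideal by blast
      have mem: "d * x \<in> M j" "x * d \<in> M j" for x
        using d by (auto intro: lower_ideal_mult)
      have two: "2 * x \<in> L n" if "x \<in> L n" for x n
        using lower_central_lin(1)[OF that that] by (simp add: mult_2)
      show "of_nat 3 * \<langle>a * \<langle>b, \<langle>c, d\<rangle>\<rangle>, e\<rangle> \<in> L (j + 3)"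
        unfolding of_nat_numeral three_mult_commutator_identity
        by (intro lower_central_lin two triple d mem)
      show "(0::nat) < 3" by simp
    qed
    have "\<langle>m, e\<rangle> \<in> L (j + 3)" if "m \<in> M (Suc (Suc j))" for m e
      using that
    proof (induction rule: lower_ideal_left_induct)
      case (mult a l)
      moreover have "1 \<le> Suc j" by simp
      ultimately show ?case
      proof (induction rule: lower_central_Suc_induct)
        case (commutator b l)
        moreover have "1 \<le> j" by (simp add: j_def)
        ultimately show ?case
        proof (induction rule: lower_central_Suc_induct)
          case (commutator c d)
          then show ?case by (rule generators)
        qed (rule subspace_preimage[OF subspace_lower_central] | simp add: add_simps scale_simps j_def)+
      qed (rule subspace_preimage[OF subspace_lower_central] | simp add: add_simps scale_simps)+
    qed (rule subspace_preimage[OF subspace_lower_central] | simp add: add_simps scale_simps)+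
    then show ?case by (simp add: j_def eval_nat_numeral)
  qed
  then show ?thesis using assms by (auto elim!: oddE)
qed

lemma lower_ideal_odd_commutator_lower_central:
  assumes "odd j" "m \<in> M j" "l \<in> L k" "1 \<le> k"
  shows "\<langle>m, l\<rangle> \<in> L (j + k)"
  using assms(4,3)
proof (induction k arbitrary: l rule: dec_induct)
  case base
  then show ?case using lower_ideal_odd_commutator assms by simp
next
  case (step k)
  from step.prems step.hyps(1) show ?case
  proof (induction rule: lower_central_Suc_induct)
    case subspace
    show ?case
      by (rule subspace_preimage[OF subspace_lower_central]) (simp_all add: add_simps scale_simps)
  next
    case (commutator a l)
    have "\<langle>\<langle>m, a\<rangle>, l\<rangle> \<in> L (Suc j + k)"
      using commutator step.hyps assms
      by (intro lower_central_commutator_lower_central lower_ideal_odd_commutator) auto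
    moreover have "\<langle>a, \<langle>m, l\<rangle>\<rangle> \<in> L (Suc (j + k))"
      using commutator step by (intro lower_central_commutator) auto
    ultimately show ?case
      using lower_central_lin(1) by (simp add: commutator_jacobi[of m])
  qed
qed

text \<open>For \<open>l = [b, a]\<close> with \<open>a\<close> in \<open>L (k - 1)\<close> one has
  \<open>m * l = [m * b, a] - [m, a] * b\<close>. Since \<open>m * b\<close> lies in
  \<open>M j\<close> along with \<open>m\<close>, the previous inclusion applies to both
  terms.\<close>

lemma lower_ideal_odd_mult_lower_central:
  assumes "odd j" "m \<in> M j" "l \<in> L k" "1 \<le> k"
  shows "m * l \<in> M (j + k - 1)"
proof (cases "k = 1")
  case True
  then show ?thesis using assms lower_ideal_mult by simp
next
  case False
  then obtain k' where k: "k = Suc k'" "1 \<le> k'" using assms(4) by (cases k) auto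
  from assms(3) k(2) show ?thesis unfolding k(1)
  proof (induction rule: lower_central_Suc_induct)
    case subspace
    show ?case
      by (rule subspace_preimage[OF subspace_lower_ideal]) (simp_all add: add_simps scale_simps)
  next
    case (commutator b a)
    have "\<langle>x, a\<rangle> \<in> M (j + k')" if "x \<in> M j" for x
      using lower_ideal_odd_commutator_lower_central[OF assms(1) that commutator k(2)]
        lower_central_subset_lower_ideal by blast
    then have "\<langle>m * b, a\<rangle> - \<langle>m, a\<rangle> * b \<in> M (j + k')"
      using assms(2) by (simp add: lower_ideal_lin lower_ideal_mult)
    then show ?case by (simp add: commutator_mult_left)
  qed
qed

text \<open>If \<open>i\<close> is even, the factors are swapped; the error \<open>[a, b]\<close>
  lies even in \<open>L (i + j)\<close>.\<close>

lemma lower_central_mult_odd: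
  assumes "odd i \<or> odd j" "a \<in> L i" "b \<in> L j" "1 \<le> i" "1 \<le> j"
  shows "a * b \<in> M (i + j - 1)"
proof (cases "odd i")
  case True
  then show ?thesis
    using lower_ideal_odd_mult_lower_central assms lower_central_subset_lower_ideal by blast
next
  case False
  then have "b * a \<in> M (j + i - 1)"
    using lower_ideal_odd_mult_lower_central assms lower_central_subset_lower_ideal by blast
  moreover have "\<langle>a, b\<rangle> \<in> M (i + j - 1)"
    using lower_central_commutator_lower_central[OF assms(2-5)] lower_central_subset_lower_ideal
      lower_ideal_antimono[of "i + j - 1" "i + j"] by auto
  moreover have "a * b = b * a + \<langle>a, b\<rangle>" by (simp add: commutator_def)
  ultimately show ?thesis using lower_ideal_lin(1) by (simp add: add.commute)
qed

text \<open>Serves the Leibniz expansions of \<open>ad_z^2\<close> on a product that, as a whole,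
  lies in an ideal of odd index.\<close>

lemma lower_ideal_odd_double_commutator:
  assumes "odd n" "m \<in> M n"
  shows "\<langle>z, \<langle>z, m\<rangle>\<rangle> \<in> M (n + 2)"
proof -
  have "\<langle>z, \<langle>m, z\<rangle>\<rangle> \<in> L (Suc (Suc n))"
    using assms by (intro lower_central_commutator lower_ideal_odd_commutator) auto
  then have "- \<langle>z, \<langle>m, z\<rangle>\<rangle> \<in> M (n + 2)"
    using lower_central_subset_lower_ideal lower_ideal_lin(3) by auto
  then show ?thesis by (simp add: commutator_def algebra_simps)
qed

section \<open>Algebras with two generators\<close>

text \<open>Among three arguments taken from two generators, two coincide. The derivation rule is
  stated in the first slot, and alternation carries every slot there.\<close>

lemma alternating_derivation_mem:
  fixes E :: "'r \<Rightarrow> 'r \<Rightarrow> 'r \<Rightarrow> 'r"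
  assumes generated: "\<And>S. \<lbrakk>subspace S; 1 \<in> S; x \<in> S; y \<in> S;
      \<And>a b. \<lbrakk>a \<in> S; b \<in> S\<rbrakk> \<Longrightarrow> a * b \<in> S\<rbrakk> \<Longrightarrow> S = UNIV"
    and I: "subspace I" "\<And>a b. b \<in> I \<Longrightarrow> a * b \<in> I"
    and add: "\<And>a b u w. E (a + b) u w = E a u w + E b u w"
      "\<And>a b u w. E u (a + b) w = E u a w + E u b w"
      "\<And>a b u w. E u w (a + b) = E u w a + E u w b"
    and scale: "\<And>c a u w. E (c *s a) u w = c *s E a u w"
    and alt: "\<And>z w. E z z w \<in> I" "\<And>z u. E z u z \<in> I"
    and deriv: "\<And>a b u w. E (a * b) u w - a * E b u w - b * E a u w \<in> I"
  shows "E z u w \<in> I"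
proof -
  note lin = subspace_add[OF I(1)] subspace_diff[OF I(1)] subspace_neg[OF I(1)]
  \<comment> \<open>Polarization: alternation at \<open>z + u\<close> gives antisymmetry modulo
    \<open>I\<close>.\<close>
  have swap12: "E u z w \<in> I" if "E z u w \<in> I" for z u w
  proof -
    have "E u z w = E (z + u) (z + u) w - E z z w - E u u w - E z u w"
      by (simp add: add algebra_simps)
    then show ?thesis using alt that by (simp only: lin)
  qed
  have swap13: "E w u z \<in> I" if "E z u w \<in> I" for z u w
  proof -
    have "E w u z = E (z + w) u (z + w) - E z u z - E w u w - E z u w"
      by (simp add: add algebra_simps)
    then show ?thesis using alt that by (simp only: lin)
  qed
  \<comment> \<open>For fixed \<open>u\<close> and \<open>w\<close> the good \<open>z\<close> form a
    subalgebra.\<close>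
  have extend: "E z u w \<in> I" if gens: "E x u w \<in> I" "E y u w \<in> I" for z u w
  proof -
    have "{z. E z u w \<in> I} = UNIV"
    proof (rule generated)
      show "subspace {z. E z u w \<in> I}" by (rule subspace_preimage[OF I(1)]) (simp_all add: add(1) scale)
      \<comment> \<open>The derivation rule at \<open>a = b = 1\<close> leaves
        \<open>- E 1 u w\<close>.\<close>
      show "1 \<in> {z. E z u w \<in> I}" using lin(3)[OF deriv[of 1 1 u w]] by simp
    next
      fix a b assume "a \<in> {z. E z u w \<in> I}" "b \<in> {z. E z u w \<in> I}"
      then have "(E (a * b) u w - a * E b u w - b * E a u w) + a * E b u w + b * E a u w \<in> I"
        using deriv I(2) by (simp only: lin mem_Collect_eq)
      then show "a * b \<in> {z. E z u w \<in> I}" by simp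
    qed (use gens in simp_all)
    then show ?thesis by blast
  qed
  have 0: "E z u w \<in> I" if "z \<in> {x, y}" "u \<in> {x, y}" "w \<in> {x, y}" for z u w
    using that alt(1)[of z w] alt(2)[of z u] swap12[OF alt(2)[of u z]] by auto
  \<comment> \<open>The slots are freed one at a time: each is brought to the front by a swap, where
    membership extends from the generators to all elements.\<close>
  have 1: "E z u w \<in> I" if "u \<in> {x, y}" "w \<in> {x, y}" for z u w
    by (rule extend[OF 0[OF _ that] 0[OF _ that]]) simp_all
  have 2: "E z u w \<in> I" if "w \<in> {x, y}" for z u w
    by (rule extend[OF swap12[OF 1[OF _ that]] swap12[OF 1[OF _ that]]]) simp_all
  show ?thesis
    by (rule extend[OF swap13[OF 2] swap13[OF 2]]) simp_all
qed

context
  fixes x y :: 'r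
  assumes generated: "\<And>S. \<lbrakk>subspace S; 1 \<in> S; x \<in> S; y \<in> S;
      \<And>a b. \<lbrakk>a \<in> S; b \<in> S\<rbrakk> \<Longrightarrow> a * b \<in> S\<rbrakk> \<Longrightarrow> S = UNIV"
begin

text \<open>Later \<open>f\<close> is the identity for \<open>p = 1\<close> and sends
  \<open>u\<close> to \<open>[u, v]\<close> for larger \<open>p\<close>. Alternation in
  \<open>z\<close> and \<open>u\<close> is a hypothesis because the two cases prove it
  differently.\<close>

lemma commutator_mult_commutator_two_generated:
  assumes "odd p" "odd q" "l \<in> L q"
    and f: "\<And>u. f u \<in> L p" "\<And>u v. f (u + v) = f u + f v"
    and alt: "\<And>z w. \<langle>z, f z\<rangle> * \<langle>w, l\<rangle> \<in> M (p + q + 1)"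
  shows "\<langle>z, f u\<rangle> * \<langle>w, l\<rangle> \<in> M (p + q + 1)"
proof -
  have pos: "1 \<le> p" "1 \<le> q" using assms(1,2) by (auto elim: oddE)
  show ?thesis
  proof (rule alternating_derivation_mem[where E = "\<lambda>z u w. \<langle>z, f u\<rangle> * \<langle>w, l\<rangle>", OF generated])
    fix z u
    \<comment> \<open>As \<open>p + q - 1\<close> is odd, \<open>ad_z^2\<close> sends
      \<open>f u * l\<close> into \<open>M (p + q + 1)\<close>. The outer Leibniz terms lie there
      too, which leaves twice \<open>[z, f u] * [z, l]\<close>.\<close>
    have "f u * l \<in> M (p + q - 1)"
      using assms pos by (intro lower_central_mult_odd) auto
    then have "\<langle>z, \<langle>z, f u * l\<rangle>\<rangle> \<in> M ((p + q - 1) + 2)"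
      using assms pos by (intro lower_ideal_odd_double_commutator) auto
    moreover have "\<langle>z, \<langle>z, f u\<rangle>\<rangle> * l \<in> M (Suc (Suc p) + q - 1)"
      using assms pos by (intro lower_central_mult_odd lower_central_commutator) auto
    moreover have "f u * \<langle>z, \<langle>z, l\<rangle>\<rangle> \<in> M (p + Suc (Suc q) - 1)"
      using assms pos by (intro lower_central_mult_odd lower_central_commutator) auto
    moreover have "of_nat 2 * (\<langle>z, f u\<rangle> * \<langle>z, l\<rangle>) =
        \<langle>z, \<langle>z, f u * l\<rangle>\<rangle> - \<langle>z, \<langle>z, f u\<rangle>\<rangle> * l - f u * \<langle>z, \<langle>z, l\<rangle>\<rangle>"
      by (simp add: commutator_def algebra_simps mult_2)
    ultimately have "of_nat 2 * (\<langle>z, f u\<rangle> * \<langle>z, l\<rangle>) \<in> M (p + q + 1)"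
      using pos by (simp add: lower_ideal_lin)
    then show "\<langle>z, f u\<rangle> * \<langle>z, l\<rangle> \<in> M (p + q + 1)"
      by (rule subspace_of_nat_multD[OF subspace_lower_ideal]) simp
  next
    fix a b u w
    \<comment> \<open>This product is the defect of the derivation rule; its first factor lies in
      \<open>L (p + 2)\<close>, of odd index.\<close>
    have "\<langle>\<langle>a, f u\<rangle>, b\<rangle> * \<langle>w, l\<rangle> \<in> M (Suc (Suc p) + Suc q - 1)"
      using assms pos
      by (intro lower_central_mult_odd lower_central_commutator lower_central_commutator') auto
    then have "\<langle>\<langle>a, f u\<rangle>, b\<rangle> * \<langle>w, l\<rangle> \<in> M (p + q + 1)"
      using lower_ideal_antimono[of "p + q + 1" "Suc (Suc p) + Suc q - 1"] by auto
    then show "\<langle>a * b, f u\<rangle> * \<langle>w, l\<rangle>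
        - a * (\<langle>b, f u\<rangle> * \<langle>w, l\<rangle>) - b * (\<langle>a, f u\<rangle> * \<langle>w, l\<rangle>) \<in> M (p + q + 1)"
      by (simp add: commutator_def algebra_simps)
  qed (use alt in \<open>simp_all add: subspace_lower_ideal lower_ideal_mult f(2) add_simps scale_simps\<close>)
qed

text \<open>Induction raises the index of the first factor by two; \<open>q\<close> stays arbitrary
  because the alternation argument calls the hypothesis at \<open>q + 2\<close>.\<close>

lemma lower_central_mult_even:
  assumes "odd p" "odd q" "a \<in> L (Suc p)" "b \<in> L (Suc q)"
  shows "a * b \<in> M (p + q + 1)"
proof -
  have step: "\<lbrakk>odd q; a \<in> L (2 * k + 2); b \<in> L (Suc q)\<rbrakk> \<Longrightarrow> a * b \<in> M (2 * k + q + 2)" for k q a b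
  proof (induction k arbitrary: q a b)
    case 0
    have "1 \<le> q" using \<open>odd q\<close> by (auto elim: oddE)
    from \<open>b \<in> L (Suc q)\<close> this show ?case
    proof (induction rule: lower_central_Suc_induct)
      case (commutator w l)
      have "a \<in> L (Suc 1)" "1 \<le> (1::nat)" using 0 by (simp_all add: numeral_2_eq_2)
      then show ?case
      proof (induction rule: lower_central_Suc_induct)
        case (commutator z u)
        then show ?case
          using commutator_mult_commutator_two_generated[of 1 q l "\<lambda>u. u" z u w] 0 \<open>l \<in> L q\<close>
          by (simp add: commutator_self lower_ideal_lin)
      qed (rule subspace_preimage[OF subspace_lower_ideal] | simp add: add_simps scale_simps)+
    qed (rule subspace_preimage[OF subspace_lower_ideal] | simp add: add_simps scale_simps)+
  next
    case (Suc k)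
    \<comment> \<open>This \<open>p\<close> belongs to the induction hypothesis; the first factor of
      the goal lies in \<open>L (p + 3)\<close>.\<close>
    define p where "p = 2 * k + 1"
    have p: "odd p" "1 \<le> Suc (Suc p)" "1 \<le> Suc p" by (simp_all add: p_def)
    have q: "1 \<le> q" using \<open>odd q\<close> by (auto elim: oddE)
    have IH: "v * b \<in> M (p + q + 1)" if "odd q" "v \<in> L (Suc p)" "b \<in> L (Suc q)" for v b q
      using Suc.IH[OF that(1) _ that(3)] that(2) by (simp add: p_def)
    \<comment> \<open>Expand \<open>ad_z^2 (v * l')\<close>: the hypothesis handles
      \<open>v * l'\<close>, of odd index \<open>p + q + 1\<close>, and
      \<open>v * [z, [z, l']]\<close>; the factors of the mixed terms have odd indices
      \<open>p + 2\<close> and \<open>q + 2\<close>. Only the wanted term remains.\<close>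
    have alt: "\<langle>z, \<langle>z, v\<rangle>\<rangle> * \<langle>w, l\<rangle> \<in> M (p + q + 3)" if v: "v \<in> L (Suc p)" and l: "l \<in> L q" for z v w l
    proof -
      define l' where "l' = \<langle>w, l\<rangle>"
      have l': "l' \<in> L (Suc q)" unfolding l'_def using l q by (rule lower_central_commutator)
      have "\<langle>z, \<langle>z, v * l'\<rangle>\<rangle> \<in> M ((p + q + 1) + 2)"
        using Suc.prems(1) p v l' by (intro lower_ideal_odd_double_commutator IH) auto
      moreover have "\<langle>z, v\<rangle> * \<langle>z, l'\<rangle> \<in> M (Suc (Suc p) + Suc (Suc q) - 1)"
        using Suc.prems(1) p v l' by (intro lower_central_mult_odd lower_central_commutator) auto
      moreover have "v * \<langle>z, \<langle>z, l'\<rangle>\<rangle> \<in> M (p + (q + 2) + 1)"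
        using Suc.prems(1) v lower_central_commutator[OF lower_central_commutator[OF l']] by (intro IH) simp_all
      moreover have "\<langle>z, \<langle>z, v\<rangle>\<rangle> * l' =
          \<langle>z, \<langle>z, v * l'\<rangle>\<rangle> - \<langle>z, v\<rangle> * \<langle>z, l'\<rangle> - \<langle>z, v\<rangle> * \<langle>z, l'\<rangle> - v * \<langle>z, \<langle>z, l'\<rangle>\<rangle>"
        by (simp add: commutator_def algebra_simps)
      ultimately show ?thesis
        unfolding l'_def[symmetric] by (simp add: lower_ideal_lin eval_nat_numeral)
    qed
    from \<open>b \<in> L (Suc q)\<close> q have "a * b \<in> M (p + q + 3)"
    proof (induction rule: lower_central_Suc_induct)
      case (commutator w l)
      note l = \<open>l \<in> L q\<close>
      have "a \<in> L (Suc (Suc (Suc p)))" using Suc.prems by (simp add: p_def)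
      from this p(2) show ?case
      proof (induction rule: lower_central_Suc_induct)
        case (commutator z m)
        from commutator p(3) show ?case
        proof (induction rule: lower_central_Suc_induct)
          case (commutator u v)
          have alt': "\<langle>z, \<langle>z, v\<rangle>\<rangle> * \<langle>w, l\<rangle> \<in> M (Suc (Suc p) + q + 1)" for z w
            using alt[OF commutator l, of z w] by (simp add: eval_nat_numeral)
          \<comment> \<open>Here \<open>[u, v]\<close> lies in \<open>L (p + 2)\<close>, so the
            alternating lemma is used with \<open>p + 2\<close> in place of
            \<open>p\<close>.\<close>
          have "\<langle>z, \<langle>u, v\<rangle>\<rangle> * \<langle>w, l\<rangle> \<in> M (Suc (Suc p) + q + 1)"
            by (rule commutator_mult_commutator_two_generated[where f = "\<lambda>u. \<langle>u, v\<rangle>"])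
              (use l Suc.prems(1) p lower_central_commutator[OF commutator p(3)] alt' in
                \<open>simp_all add: commutator_add_left\<close>)
          then show ?case by (simp add: eval_nat_numeral)
        qed (rule subspace_preimage[OF subspace_lower_ideal] | simp add: add_simps scale_simps)+
      qed (rule subspace_preimage[OF subspace_lower_ideal] | simp add: add_simps scale_simps)+
    qed (rule subspace_preimage[OF subspace_lower_ideal] | simp add: add_simps scale_simps)+
    then show ?case by (simp add: p_def eval_nat_numeral)
  qed
  obtain k where "p = 2 * k + 1" using assms(1) by (elim oddE)
  then show ?thesis using step[of q a k b] assms by simp
qed

text \<open>Outer coefficients stay outside, and in \<open>a * (u * l * v)\<close> the middle
  \<open>u\<close> is absorbed into \<open>a\<close>, since \<open>M i\<close> is an ideal.\<close>

lemma lower_ideal_mult_lower_ideal: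
  assumes "a \<in> M i" "b \<in> M j" "1 \<le> i" "1 \<le> j"
  shows "a * b \<in> M (i + j - 1)"
proof -
  have gens: "a * b \<in> M (i + j - 1)" if "a \<in> L i" "b \<in> L j" for a b
  proof (cases "odd i \<or> odd j")
    case False
    moreover obtain p q where "i = Suc p" "j = Suc q" using assms(3,4) by (cases i; cases j) auto
    ultimately show ?thesis using lower_central_mult_even[of p q a b] that by simp
  qed (use lower_central_mult_odd that assms in blast)
  have left: "a * b \<in> M (i + j - 1)" if "a \<in> M i" "b \<in> L j" for a b
    using that(1)
  proof (induction rule: lower_ideal_left_induct)
    case (mult u l)
    then show ?case using gens that(2) lower_ideal_mult by (simp add: mult.assoc)
  qed (rule subspace_preimage[OF subspace_lower_ideal] | simp add: add_simps scale_simps)+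
  from assms(2) show ?thesis
  proof (induction rule: lower_ideal_induct)
    case (mult u l v)
    then have "a * u * l * v \<in> M (i + j - 1)"
      using lower_ideal_mult_right[OF left[OF lower_ideal_mult_right[OF assms(1)]]] by blast
    then show ?case by (simp add: mult.assoc)
  qed (rule subspace_preimage[OF subspace_lower_ideal] | simp add: add_simps scale_simps)+
qed

lemma lower_ideal_product_subset:
  assumes "ps \<noteq> []" "\<forall>p \<in> set ps. 1 \<le> p"
  shows "lower_ideal_product ps \<subseteq> M (sum_list ps - length ps + 1)"
proof -
  \<comment> \<open>The bound \<open>length ps \<le> sum_list ps\<close> is carried along because
    subtraction on naturals truncates.\<close>
  have "prod_list xs \<in> M (sum_list ps - length ps + 1) \<and> length ps \<le> sum_list ps"
    if "list_all2 (\<lambda>x p. x \<in> M p) xs ps" for xs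
    using that assms
  proof (induction rule: list_all2_induct)
    case (Cons x xs p ps)
    show ?case
    proof (cases "ps = []")
      case True
      then show ?thesis using Cons by simp
    next
      case False
      then have "prod_list xs \<in> M (sum_list ps - length ps + 1)" and le: "length ps \<le> sum_list ps"
        using Cons by simp_all
      then have "x * prod_list xs \<in> M (p + (sum_list ps - length ps + 1) - 1)"
        using Cons by (intro lower_ideal_mult_lower_ideal) auto
      moreover have "p + (sum_list ps - length ps + 1) - 1 = sum_list (p # ps) - length (p # ps) + 1"
        using le Cons.prems(2) by simp linarith
      ultimately show ?thesis using le Cons.prems by simp
    qed
  qed simp
  then show ?thesis
    unfolding lower_ideal_product_def by (intro span_minimal subspace_lower_ideal) blast
qed

end

end

section \<open>A representation detecting the lower central ideals of the free algebra\<close>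

interpretation char_0_free_algebra: char_0_algebra
  "free_algebra_scale :: 'k::field_char_0 \<Rightarrow> ('k, 'x) free_algebra \<Rightarrow> _" ..

section \<open>Generation of the free algebra by words and letters\<close>

definition generator :: "'x \<Rightarrow> ('k::field, 'x) free_algebra"
  where "generator k = Poly_Mapping.single (Word [k]) 1"

lemma free_algebra_word_induct [case_names subspace word]:
  fixes f :: "('k::field, 'x) free_algebra"
  assumes "free_algebra.subspace {f. P f}" "\<And>ws. P (Poly_Mapping.single (Word ws) 1)"
  shows "P f"
proof -
  have scale: "free_algebra_scale c (Poly_Mapping.single w 1) = Poly_Mapping.single w c"
    for c :: 'k and w :: "'x free_monoid"
    by (simp add: free_algebra_scale_eq_mult mult_single)
  have "f = (\<Sum>w\<in>Poly_Mapping.keys f. Poly_Mapping.single w (Poly_Mapping.lookup f w))"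
    by (rule poly_mapping_eqI) (simp add: lookup_sum lookup_single when_def in_keys_iff)
  also have "\<dots> \<in> {f. P f}"
  proof (rule free_algebra.subspace_sum[OF assms(1)])
    fix w show "Poly_Mapping.single w (Poly_Mapping.lookup f w) \<in> {f. P f}"
      using free_algebra.subspace_scale[OF assms(1), of "Poly_Mapping.single w 1" "Poly_Mapping.lookup f w"]
        assms(2)[of "letters w"] by (simp add: scale)
  qed
  finally show ?thesis by simp
qed

lemma free_algebra_generated:
  fixes S :: "('k::field, 'x) free_algebra set"
  assumes "free_algebra.subspace S" "1 \<in> S" "\<And>k. generator k \<in> S"
    and mult: "\<And>a b. \<lbrakk>a \<in> S; b \<in> S\<rbrakk> \<Longrightarrow> a * b \<in> S"
  shows "S = UNIV"
proof -
  have word: "Poly_Mapping.single (Word ws) 1 \<in> S" for ws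
  proof (induction ws)
    case Nil
    have "Poly_Mapping.single (Word []) 1 = (1 :: ('k, 'x) free_algebra)"
      by (simp flip: zero_free_monoid_def)
    then show ?case using assms(2) by simp
  next
    case (Cons k ws)
    have "Poly_Mapping.single (Word (k # ws)) 1
        = generator k * (Poly_Mapping.single (Word ws) 1 :: ('k, 'x) free_algebra)"
      by (simp add: generator_def mult_single plus_free_monoid_def)
    then show ?case using mult[OF assms(3) Cons] by simp
  qed
  have "f \<in> S" for f
    by (induction f rule: free_algebra_word_induct) (simp_all add: assms(1) word)
  then show ?thesis by blast
qed

lemma exhaust_2: "k = 0 \<or> k = 1" for k :: 2
proof -
  have "{0, 1} = (UNIV :: 2 set)" by (rule card_seteq) simp_all
  then show ?thesis by blast
qed

lemma A2_generated:
  fixes S :: "'k::field_char_0 A2 set"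
  assumes "free_algebra.subspace S" "1 \<in> S" "generator 0 \<in> S" "generator 1 \<in> S"
    and "\<And>a b. \<lbrakk>a \<in> S; b \<in> S\<rbrakk> \<Longrightarrow> a * b \<in> S"
  shows "S = UNIV"
proof (rule free_algebra_generated)
  show "generator k \<in> S" for k using exhaust_2[of k] assms(3,4) by auto
qed (use assms in blast)+

section \<open>The operators on \<open>K[h][t]\<close>\<close>

text \<open>In \<^typ>\<open>'k poly poly\<close> the outer variable is \<open>t\<close> and the inner one is \<open>h\<close>.\<close>

definition letter_act :: "2 \<Rightarrow> 'k::field_char_0 poly poly \<Rightarrow> 'k poly poly"
  where "letter_act k p = (if k = 0 then smult (monom 1 1) (pderiv p) else pCons 0 p)"

definition word_act :: "2 free_monoid \<Rightarrow> 'k::field_char_0 poly poly \<Rightarrow> 'k poly poly"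
  where "word_act w = foldr letter_act (letters w)"

definition act :: "'k::field_char_0 A2 \<Rightarrow> 'k poly poly \<Rightarrow> 'k poly poly"
  where "act f p = (\<Sum>w\<in>Poly_Mapping.keys f. smult [:Poly_Mapping.lookup f w:] (word_act w p))"

lemma letter_act_add: "letter_act k (p + q) = letter_act k p + letter_act k q"
  and letter_act_smult: "letter_act k (smult c p) = smult c (letter_act k p)"
  by (simp_all add: letter_act_def pderiv_add pderiv_smult smult_add_right mult.commute)

lemma word_act_add: "word_act w (p + q) = word_act w p + word_act w q"
  and word_act_smult: "word_act w (smult c p) = smult c (word_act w p)"
proof -
  have "foldr letter_act ws (p + q) = foldr letter_act ws p + foldr letter_act ws q"
    "foldr letter_act ws (smult c p) = smult c (foldr letter_act ws p)" for ws
    by (induction ws) (simp_all add: letter_act_add letter_act_smult)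
  then show "word_act w (p + q) = word_act w p + word_act w q"
    "word_act w (smult c p) = smult c (word_act w p)"
    by (simp_all add: word_act_def)
qed

lemma smult_sum_right: "smult c (\<Sum>i\<in>A. f i) = (\<Sum>i\<in>A. smult c (f i))"
  by (induction A rule: infinite_finite_induct) (simp_all add: smult_add_right)

lemma act_superset:
  assumes "finite B" "Poly_Mapping.keys f \<subseteq> B"
  shows "act f p = (\<Sum>w\<in>B. smult [:Poly_Mapping.lookup f w:] (word_act w p))"
  unfolding act_def using assms
  by (intro sum.mono_neutral_left) (auto simp: in_keys_iff)

lemma act_add_left: "act (f + g) p = act f p + act g p"
proof -
  have "Poly_Mapping.keys (f + g) \<subseteq> Poly_Mapping.keys f \<union> Poly_Mapping.keys g" by (rule Poly_Mapping.keys_add)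
  then show ?thesis
    by (simp add: act_superset[of "Poly_Mapping.keys f \<union> Poly_Mapping.keys g"] lookup_add
        flip: sum.distrib smult_add_left)
qed

lemma act_scale: "act (free_algebra_scale c f) p = smult [:c:] (act f p)"
proof -
  have "Poly_Mapping.keys (free_algebra_scale c f) \<subseteq> Poly_Mapping.keys f"
    by (auto simp: in_keys_iff free_algebra_scale.rep_eq)
  then show ?thesis
    using act_superset[of "Poly_Mapping.keys f" "free_algebra_scale c f"]
    by (simp add: act_def free_algebra_scale.rep_eq smult_sum_right mult.commute)
qed

lemma act_zero_left: "act 0 p = 0"
  by (simp add: act_def)

lemma act_diff_left: "act (f - g) p = act f p - act g p"
  using act_add_left[of "f - g" g p] by simp

lemma act_add_right: "act f (p + q) = act f p + act f q"
  by (simp add: act_def word_act_add smult_add_right sum.distrib)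

lemma act_smult: "act f (smult c p) = smult c (act f p)"
  by (simp add: act_def word_act_smult smult_sum_right mult.commute)

lemma act_zero_right: "act f 0 = 0"
  using act_smult[of f 0 0] by simp

lemma act_word: "act (Poly_Mapping.single w 1) p = word_act w p"
  by (simp add: act_def flip: one_pCons)

lemma act_one: "act 1 p = p"
proof -
  have "letters (0 :: 2 free_monoid) = []" by (simp add: zero_free_monoid_def)
  then show ?thesis using act_word[of 0 p] by (simp add: word_act_def)
qed

lemma act_generator: "act (generator k) p = letter_act k p"
  by (simp add: generator_def act_word word_act_def)

text \<open>Both sides are linear in \<open>f\<close> and in \<open>g\<close>, which leaves words,
  where concatenation is composition.\<close>

lemma act_mult: "act (f * g) p = act f (act g p)"
proof (induction f arbitrary: g p rule: free_algebra_word_induct)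
  case subspace
  show ?case
    by (auto simp: free_algebra.subspace_def act_zero_left act_add_left act_scale distrib_right
        free_algebra.scale_mult_left)
next
  case (word ws)
  show ?case
  proof (induction g rule: free_algebra_word_induct)
    case subspace
    show ?case
      by (auto simp: free_algebra.subspace_def act_zero_left act_zero_right act_add_left act_add_right act_scale
        act_smult distrib_left free_algebra.scale_mult_right)
  next
    case (word vs)
    show ?case by (simp add: mult_single act_word word_act_def plus_free_monoid_def)
  qed
qed

lemmas act_simps = act_zero_left act_add_left act_diff_left act_scale act_mult act_one act_smult

section \<open>Divisibility of operators by powers of \<open>h\<close>\<close>

text \<open>The quotient has to be the operator of an algebra element, so that commutators can be
  taken with it again.\<close>

definition h_divisible :: "nat \<Rightarrow> 'k::field_char_0 A2 set"
  where "h_divisible m = {f. \<exists>g. \<forall>p. act f p = smult (monom 1 m) (act g p)}"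

lemma h_divisibleI: "(\<And>p. act f p = smult (monom 1 m) (act g p)) \<Longrightarrow> f \<in> h_divisible m"
  unfolding h_divisible_def by blast

lemma subspace_h_divisible: "free_algebra.subspace (h_divisible m)"
  unfolding free_algebra.subspace_def
proof (intro conjI allI ballI)
  show "0 \<in> h_divisible m"
    by (rule h_divisibleI[where g = 0]) (simp add: act_simps)
next
  fix f g :: "'a A2" assume "f \<in> h_divisible m" "g \<in> h_divisible m"
  then obtain f' g' where "\<And>p. act f p = smult (monom 1 m) (act f' p)"
    "\<And>p. act g p = smult (monom 1 m) (act g' p)" by (auto simp: h_divisible_def)
  then show "f + g \<in> h_divisible m"
    by (intro h_divisibleI[where g = "f' + g'"]) (simp add: act_simps smult_add_right)
next
  fix c and f :: "'a A2" assume "f \<in> h_divisible m"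
  then obtain f' where "\<And>p. act f p = smult (monom 1 m) (act f' p)"
    by (auto simp: h_divisible_def)
  then show "free_algebra_scale c f \<in> h_divisible m"
    by (intro h_divisibleI[where g = "free_algebra_scale c f'"]) (simp add: act_simps mult.commute)
qed

lemma h_divisible_mult:
  assumes "f \<in> h_divisible m"
  shows "a * f \<in> h_divisible m" "f * a \<in> h_divisible m"
proof -
  from assms obtain f' where f': "\<And>p. act f p = smult (monom 1 m) (act f' p)"
    by (auto simp: h_divisible_def)
  show "a * f \<in> h_divisible m"
    by (rule h_divisibleI[where g = "a * f'"]) (simp add: act_simps f')
  show "f * a \<in> h_divisible m"
    by (rule h_divisibleI[where g = "f' * a"]) (simp add: act_simps f')
qed

text \<open>The map sending \<open>a\<close> to \<open>[a, g]\<close> is a derivation and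
  \<open>h_divisible m\<close> an ideal, so the good \<open>a\<close> form a subalgebra.\<close>

lemma commutator_h_divisible_subalgebra:
  fixes g :: "'k::field_char_0 A2"
  assumes gens: "\<langle>generator 0, g\<rangle> \<in> h_divisible m" "\<langle>generator 1, g\<rangle> \<in> h_divisible m"
  shows "\<langle>a, g\<rangle> \<in> h_divisible m"
proof -
  have "{a. \<langle>a, g\<rangle> \<in> h_divisible m} = UNIV"
  proof (rule A2_generated)
    show "free_algebra.subspace {a. \<langle>a, g\<rangle> \<in> h_divisible m}"
      by (rule free_algebra.subspace_preimage[OF subspace_h_divisible])
        (simp_all add: commutator_add_left free_algebra.commutator_scale_left)
    show "1 \<in> {a. \<langle>a, g\<rangle> \<in> h_divisible m}"
      using free_algebra.subspace_0[OF subspace_h_divisible] by (simp add: commutator_def)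
  next
    fix a b assume "a \<in> {a. \<langle>a, g\<rangle> \<in> h_divisible m}" "b \<in> {a. \<langle>a, g\<rangle> \<in> h_divisible m}"
    then show "a * b \<in> {a. \<langle>a, g\<rangle> \<in> h_divisible m}"
      by (simp add: commutator_mult_left h_divisible_mult
          free_algebra.subspace_add[OF subspace_h_divisible])
  qed (use gens in simp_all)
  then show ?thesis by blast
qed

lemma commutator_h_divisible_1: "\<langle>a, b\<rangle> \<in> h_divisible 1"
proof -
  \<comment> \<open>\<open>h d/dt (t p) - t h d/dt p = h p\<close>, so the quotient is the operator
    of \<open>1\<close>.\<close>
  have xy: "\<langle>generator 0, generator 1\<rangle> \<in> h_divisible 1"
    by (rule h_divisibleI[where g = 1])
      (simp add: commutator_def act_simps act_generator letter_act_def pderiv_pCons smult_add_right)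
  have swap: "\<langle>b, a\<rangle> \<in> h_divisible 1" if "\<langle>a, b\<rangle> \<in> h_divisible 1" for a b :: "'a A2"
    using free_algebra.subspace_neg[OF subspace_h_divisible that] by (simp add: commutator_swap[of b])
  have self: "\<langle>a, a\<rangle> \<in> h_divisible 1" for a :: "'a A2"
    using free_algebra.subspace_0[OF subspace_h_divisible] by (simp add: commutator_self)
  have "\<langle>a, generator 0\<rangle> \<in> h_divisible 1" "\<langle>a, generator 1\<rangle> \<in> h_divisible 1" for a :: "'a A2"
    using commutator_h_divisible_subalgebra[OF self swap[OF xy]]
      commutator_h_divisible_subalgebra[OF xy self] by blast+
  then show ?thesis
    using commutator_h_divisible_subalgebra[OF swap swap] by blast
qed

text \<open>As \<open>h^m\<close> is central, \<open>[a, f]\<close> acts as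
  \<open>h^m [a, f']\<close>, and the commutator \<open>[a, f']\<close> contributes one more
  \<open>h\<close>.\<close>

lemma commutator_h_divisible:
  assumes "f \<in> h_divisible m" shows "\<langle>a, f\<rangle> \<in> h_divisible (Suc m)"
proof -
  from assms obtain f' where f': "\<And>p. act f p = smult (monom 1 m) (act f' p)"
    by (auto simp: h_divisible_def)
  obtain g where g: "\<And>p. act \<langle>a, f'\<rangle> p = smult (monom 1 1) (act g p)"
    using commutator_h_divisible_1[of a f'] by (auto simp: h_divisible_def)
  have "act \<langle>a, f\<rangle> p = smult (monom 1 m) (act \<langle>a, f'\<rangle> p)" for p
    by (simp add: commutator_def act_simps f' smult_diff_right)
  then show ?thesis
    by (intro h_divisibleI[where g = g]) (simp add: g mult_monom)
qed

lemma lower_central_h_divisible: "free_algebra.lower_central (Suc n) \<subseteq> (h_divisible n :: 'k::field_char_0 A2 set)"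
proof (induction n)
  case 0
  have "f \<in> h_divisible 0" for f :: "'k A2"
    by (rule h_divisibleI[where g = f]) (simp add: monom_0 flip: one_pCons)
  then show ?case by blast
next
  case (Suc n)
  show ?case
  proof
    fix f :: "'k A2" assume "f \<in> free_algebra.lower_central (Suc (Suc n))"
    moreover have "1 \<le> Suc n" by simp
    ultimately show "f \<in> h_divisible (Suc n)"
      by (induction rule: free_algebra.lower_central_Suc_induct)
        (use Suc in \<open>auto simp: subspace_h_divisible intro: commutator_h_divisible\<close>)
  qed
qed

lemma lower_ideal_h_divisible: "free_algebra.lower_ideal (Suc n) \<subseteq> (h_divisible n :: 'k::field_char_0 A2 set)"
proof
  fix f :: "'k A2" assume "f \<in> free_algebra.lower_ideal (Suc n)"
  then show "f \<in> h_divisible n"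
  proof (induction rule: free_algebra.lower_ideal_induct)
    case (mult a l b)
    then show ?case
      using lower_central_h_divisible[of n] by (intro h_divisible_mult(2)[OF h_divisible_mult(1)]) auto
  qed (simp add: subspace_h_divisible)
qed

section \<open>Elements that attain the bound\<close>

definition ad_power :: "nat \<Rightarrow> 'k::field_char_0 A2"
  where "ad_power n = (commutator (generator 0) ^^ n) (generator 1 ^ n)"

lemma ad_power_lower_central: "ad_power n \<in> free_algebra.lower_central (Suc n)"
proof -
  have "(commutator a ^^ n) b \<in> free_algebra.lower_central (Suc n)" for a b :: "'k::field_char_0 A2"
    by (induction n) (simp_all add: free_algebra.lower_central_commutator)
  then show ?thesis by (simp add: ad_power_def)
qed

lemma act_ad_power: "\<exists>c. c \<noteq> 0 \<and> act (ad_power n :: 'k::field_char_0 A2) 1 = [:monom c n:]"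
proof -
  have y: "act (generator 1 ^ n) 1 = (monom 1 n :: 'k poly poly)" for n
    by (induction n)
      (simp_all add: act_simps act_generator letter_act_def monom_Suc)
  \<comment> \<open>The first generator kills \<open>1\<close>, so at \<open>1\<close> a commutator
    with it is plain application of \<open>h d/dt\<close>.\<close>
  have x: "act ((commutator (generator 0) ^^ n) f) 1 = (letter_act 0 ^^ n) (act f 1)" for n and f :: "'k A2"
  proof (induction n)
    case (Suc n)
    have "letter_act 0 1 = (0 :: 'k poly poly)" by (simp add: letter_act_def)
    then show ?case
      using Suc by (simp add: commutator_def act_simps act_generator act_zero_right)
  qed simp
  have "letter_act 0 (monom (monom c m) (Suc n)) = monom (monom (of_nat (Suc n) * c) (Suc m)) n"
    for c :: 'k and m n
    unfolding letter_act_def pderiv_monom of_nat_poly by (simp add: smult_monom mult_monom)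
  \<comment> \<open>Each application trades a \<open>t\<close> for an \<open>h\<close>. Peeling off
    the innermost one changes \<open>c\<close> and \<open>m\<close>, so both are arbitrary.\<close>
  then have "(letter_act 0 ^^ n) (monom (monom c m) n) = [:monom (fact n * c) (n + m):]" for c :: 'k and m
    by (induction n arbitrary: c m)
      (simp_all add: monom_0 funpow_Suc_right algebra_simps del: funpow.simps)
  \<comment> \<open>Started at \<open>t^n\<close>; the constant \<open>fact n\<close> is nonzero in
    characteristic zero.\<close>
  from this[of 1 0] show ?thesis
    by (intro exI[of _ "fact n"]) (simp add: ad_power_def x y monom_0 flip: one_pCons)
qed

text \<open>The later factors send \<open>1\<close> to a polynomial free of \<open>t\<close>, a
  scalar of \<open>K[h]\<close> that the next factor lets through. Hence constants multiply and
  exponents add.\<close>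

lemma act_prod_list_ad_power:
  "\<exists>c. c \<noteq> 0 \<and> act (prod_list (map ad_power ns) :: 'k::field_char_0 A2) 1 = [:monom c (sum_list ns):]"
proof (induction ns)
  case Nil
  show ?case by (intro exI[of _ 1]) (simp add: act_one monom_0 one_pCons)
next
  case (Cons n ns)
  then obtain c where c: "c \<noteq> 0" "act (prod_list (map ad_power ns) :: 'k A2) 1 = [:monom c (sum_list ns):]"
    by blast
  obtain d where d: "d \<noteq> 0" "act (ad_power n :: 'k A2) 1 = [:monom d n:]"
    using act_ad_power by blast
  have "act (prod_list (map ad_power (n # ns)) :: 'k A2) 1
      = act (ad_power n) (smult (monom c (sum_list ns)) 1)"
    by (simp add: act_mult c)
  also have "\<dots> = [:monom (c * d) (n + sum_list ns):]"
    by (simp only: act_smult d) (simp add: mult_monom add.commute)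
  finally show ?case using c(1) d(1) by (intro exI[of _ "c * d"]) simp
qed

lemma lower_ideal_product_not_subset:
  assumes "\<forall>p \<in> set ps. 1 \<le> p"
  shows "\<not> free_algebra.lower_ideal_product ps
    \<subseteq> (free_algebra.lower_ideal (sum_list ps - length ps + 2) :: 'k::field_char_0 A2 set)"
proof
  assume sub: "free_algebra.lower_ideal_product ps
    \<subseteq> (free_algebra.lower_ideal (sum_list ps - length ps + 2) :: 'k A2 set)"
  \<comment> \<open>The shift is chosen so that \<open>ad_power (p - 1)\<close> lies in
    \<open>L p\<close>.\<close>
  define ns where "ns = map (\<lambda>p. p - 1) ps"
  define w :: "'k A2" where "w = prod_list (map ad_power ns)"
  have sum: "sum_list ps - length ps = sum_list ns"
    unfolding ns_def using assms
  proof (induction ps)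
    case (Cons p ps)
    moreover from Cons.prems have "length ps \<le> sum_list ps"
      by (induction ps) auto
    ultimately show ?case by simp
  qed simp
  have "list_all2 (\<lambda>x p. x \<in> free_algebra.lower_ideal p) (map ad_power ns :: 'k A2 list) ps"
    unfolding ns_def using assms
  proof (induction ps)
    case (Cons p ps)
    then show ?case
      using ad_power_lower_central[of "p - 1"] free_algebra.lower_central_subset_lower_ideal by auto
  qed simp
  then have "w \<in> free_algebra.lower_ideal_product ps"
    unfolding free_algebra.lower_ideal_product_def w_def by (intro free_algebra.span_base) blast
  then have "w \<in> h_divisible (Suc (sum_list ns))"
    using sub lower_ideal_h_divisible[of "Suc (sum_list ns)"] by (auto simp: sum)
  then obtain g where "act w 1 = smult (monom 1 (Suc (sum_list ns))) (act g 1)"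
    by (auto simp: h_divisible_def)
  moreover obtain c where "c \<noteq> 0" "act w 1 = [:monom c (sum_list ns):]"
    using act_prod_list_ad_power unfolding w_def by blast
  \<comment> \<open>In the coefficient of \<open>t^0\<close>, compare the power of \<open>h\<close>
    with exponent \<open>sum_list ns\<close>: it is \<open>c\<close> on the left, and a multiple of
    the next power of \<open>h\<close> has none.\<close>
  ultimately have "coeff (monom c (sum_list ns)) (sum_list ns)
      = coeff (monom 1 (Suc (sum_list ns)) * coeff (act g 1) 0) (sum_list ns)"
    by (metis coeff_pCons_0 coeff_smult)
  then show False using \<open>c \<noteq> 0\<close> by (simp add: coeff_monom_mult)
qed

theorem theorem1p7:
  fixes i :: "nat list"
  assumes "i \<noteq> []"
    and "\<forall>p \<in> set i. 2 \<le> p"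
  shows "assoc_unital_algebra.max_index (A2_scale :: 'k::field_char_0 \<Rightarrow> _) i
      = sum_list i - length i + 1
    \<and> assoc_unital_algebra.lower_ideal_product (A2_scale :: 'k \<Rightarrow> _) i
        \<subseteq> assoc_unital_algebra.lower_ideal (A2_scale :: 'k \<Rightarrow> _)
            (sum_list i - length i + 1)
    \<and> \<not> assoc_unital_algebra.lower_ideal_product (A2_scale :: 'k \<Rightarrow> _) i
        \<subseteq> assoc_unital_algebra.lower_ideal (A2_scale :: 'k \<Rightarrow> _)
            (sum_list i - length i + 2)"
proof -
  define N where "N = sum_list i - length i"
  have pos: "\<forall>p \<in> set i. 1 \<le> p" using assms(2) by auto
  have sub: "free_algebra.lower_ideal_product i \<subseteq> (free_algebra.lower_ideal (N + 1) :: 'k A2 set)"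
    unfolding N_def
    by (rule char_0_free_algebra.lower_ideal_product_subset[OF _ assms(1) pos]) (fact A2_generated)
  have not_sub: "\<not> free_algebra.lower_ideal_product i \<subseteq> (free_algebra.lower_ideal (N + 2) :: 'k A2 set)"
    unfolding N_def using pos by (rule lower_ideal_product_not_subset)
  have "assoc_unital_algebra.max_index (A2_scale :: 'k \<Rightarrow> _) i = N + 1"
    unfolding free_algebra.max_index_def
  proof (rule Greatest_equality)
    \<comment> \<open>The ideals decrease, so containment for a larger \<open>m\<close> would give
      the refuted one at \<open>N + 2\<close>.\<close>
    fix m assume m: "1 \<le> m \<and> free_algebra.lower_ideal_product i \<subseteq> (free_algebra.lower_ideal m :: 'k A2 set)"
    show "m \<le> N + 1"
    proof (rule ccontr)
      assume "\<not> m \<le> N + 1"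
      then have "(free_algebra.lower_ideal m :: 'k A2 set) \<subseteq> free_algebra.lower_ideal (N + 2)"
        by (intro free_algebra.lower_ideal_antimono) simp
      then show False using m not_sub by blast
    qed
  qed (use sub in simp)
  then show ?thesis using sub not_sub by (simp add: N_def)
qed

end
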